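(* Let $n\ge1$, $x^*\in\mathbb{R}^n$, $A>0$ and $$f(x)=\|x-x^*\|_2^2+A\sum_{i=1}^n\bigl(1-\cos2\pi(x_i-x_i^* )\bigr).$$ For $\tau\ge0$ let $f_\tau(x)=\mathbb{E}_uf(x+\tau u)$ with $u$ uniform on $[-1,1]^n$. Then $$\partial_if_\tau(x)=2(x_i-x_i^* )+c(\tau)\sin2\pi(x_i-x_i^* ),\qquad c(\tau)=2\pi A\,s(\tau),\quad s(\tau)=\frac{\sin2\pi\tau}{2\pi\tau}\ (s(0)=1),$$ and $f_\tau\in\mathcal{U}(x^*,\mathbb{R}^n)$ if and only if $$-\frac1\pi\le c(\tau)<c_+,\qquad c_+=\min_{t\in(1/2,1)}\frac{2t}{-\sin2\pi t}=1.46528\ldots$$ In particular: (i) for $\tau\ge\pi A$ the condition always holds, since $|c(\tau)|\le A/\tau\le1/\pi$; (ii) for $\tau=k/2$ with $k\in\mathbb{N}$, $k\ge1$, one has $s(\tau)=0$ and $f_\tau(x)=\|x-x^*\|_2^2+\mathrm{const}$.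
   Context: Class $\mathcal{U}(x^*,\mathbb{R}^n)$: differentiable functions $g$ on $\mathbb{R}^n$ such that $\partial_ig(x)(x_i-x_i^* )>0$ for every $x\in\mathbb{R}^n$ and every $i$ with $x_i\ne x_i^*$. *)

theory Defs
  imports "HOL-Probability.Probability"
begin

definition partial_deriv :: "'n::finite \<Rightarrow> (real ^ 'n \<Rightarrow> real) \<Rightarrow> real ^ 'n \<Rightarrow> real" where
  "partial_deriv i g x = deriv (\<lambda>t. g (x + t *\<^sub>R axis i 1)) 0"

definition partial_differentiable :: "'n::finite \<Rightarrow> (real ^ 'n \<Rightarrow> real) \<Rightarrow> real ^ 'n \<Rightarrow> bool" where
  "partial_differentiable i g x \<longleftrightarrow> (\<lambda>t. g (x + t *\<^sub>R axis i 1)) field_differentiable (at 0)"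

definition class_U :: "real ^ 'n \<Rightarrow> (real ^ 'n \<Rightarrow> real) set" where
  "class_U xs = {g. (\<forall>x. g differentiable (at x)) \<and>
     (\<forall>x i. x $ i \<noteq> xs $ i \<longrightarrow> partial_deriv i g x * (x $ i - xs $ i) > 0)}"

definition rastrigin :: "real \<Rightarrow> real ^ 'n \<Rightarrow> real ^ 'n \<Rightarrow> real" where
  "rastrigin A xs x = (norm (x - xs))\<^sup>2 + A * (\<Sum>i\<in>UNIV. 1 - cos (2 * pi * (x $ i - xs $ i)))"

definition smoothing :: "real \<Rightarrow> (real ^ 'n \<Rightarrow> real) \<Rightarrow> real ^ 'n \<Rightarrow> real" where
  "smoothing \<tau> f x =
     (LINT u | uniform_measure lborel (cbox (\<chi> i. - 1) (\<chi> i. 1)). f (x + \<tau> *\<^sub>R u))"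

definition s_factor :: "real \<Rightarrow> real" where
  "s_factor \<tau> = (if \<tau> = 0 then 1 else sin (2 * pi * \<tau>) / (2 * pi * \<tau>))"

definition c_coeff :: "real \<Rightarrow> real \<Rightarrow> real" where
  "c_coeff A \<tau> = 2 * pi * A * s_factor \<tau>"

definition ratio :: "real \<Rightarrow> real" where
  "ratio t = 2 * t / (- sin (2 * pi * t))"

(* LEAST only denotes the minimum if the minimum is attained, so attainment has to be
   asserted separately wherever c_plus is used. *)
definition c_plus :: real where
  "c_plus = (LEAST c. c \<in> ratio ` {1/2<..<1})"

end

theory Submission
  imports Defs
begin

text \<open>
  The Rastrigin function is a sum of functions of single coordinates, and the coordinates of a
  uniform vector in the cube are uniform on \<open>{-1..1}\<close> (\<open>distr_uniform_cbox_component\<close>). Smoothing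
  therefore acts coordinatewise: it adds a constant and multiplies the cosines by
  \<open>s_factor \<tau>\<close> (\<open>smoothing_rastrigin\<close>). With \<open>y = x $ i - xs $ i\<close>, every partial derivative is the
  same odd function \<open>2 * y + c * sin (2 * pi * y)\<close> of one real variable, where \<open>c = c_coeff A \<tau>\<close>.
  Membership in \<open>class_U\<close> thus says that this function is positive for all \<open>y > 0\<close>, whatever the
  dimension.

  Positivity can fail in two ways (\<open>derivative_sign_iff\<close>). A negative \<open>c\<close> is most harmful at
  \<open>y = 0\<close>, where the slope is \<open>2 + 2 * pi * c\<close>, which gives the threshold \<open>- 1 / pi\<close>. A positive
  \<open>c\<close> matters only where the sine is negative, first on \<open>{1/2<..<1}\<close>, and there the condition is
  \<open>c < ratio y\<close>. That the minimum of \<open>ratio\<close> on this open interval exists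
  (\<open>ratio_attains_min\<close>), and its decimal value (\<open>c_plus_bounds\<close>), both follow from convexity of the
  sine on \<open>{pi..2 * pi}\<close>: the graph lies above its tangents (\<open>sin_above_tangent\<close>).
\<close>

section \<open>Smoothing the Rastrigin function\<close>

text \<open>The marginals of a uniform distribution on a box are uniform because Lebesgue measure is a
  product measure: restricting one coordinate to \<open>T\<close> changes one factor of the volume, and the
  product \<open>P\<close> of the other side lengths cancels in the conditional probability. This is what
  reduces the smoothing of a separable function to one-dimensional integrals.\<close>

lemma distr_uniform_cbox_component:
  fixes a b :: "'a::euclidean_space"
  assumes lt: "\<And>j. j \<in> Basis \<Longrightarrow> a \<bullet> j < b \<bullet> j" and i: "i \<in> Basis"
  shows "distr (uniform_measure lborel (cbox a b)) borel (\<lambda>u. u \<bullet> i)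
    = uniform_measure lborel {a \<bullet> i..b \<bullet> i}" (is "?L = ?R")
proof (rule measure_eqI)
  show "sets ?L = sets ?R" by simp
  fix S assume "S \<in> sets ?L"
  then have S [measurable]: "S \<in> sets borel" by simp
  define P where "P = (\<Prod>j\<in>Basis - {i}. ennreal (b \<bullet> j - a \<bullet> j))"
  have "P = ennreal (\<Prod>j\<in>Basis - {i}. b \<bullet> j - a \<bullet> j)"
    unfolding P_def using lt by (intro prod_ennreal) (simp add: less_imp_le)
  moreover have "0 < (\<Prod>j\<in>Basis - {i}. b \<bullet> j - a \<bullet> j)"
    using lt by (intro prod_pos) simp
  ultimately have P: "P \<noteq> 0" "P \<noteq> \<infinity>"
    by (metis ennreal_eq_0_iff not_less, metis ennreal_neq_top infinity_ennreal_def)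
  have slab: "emeasure lborel (cbox a b \<inter> {u. u \<bullet> i \<in> T}) = emeasure lborel ({a \<bullet> i..b \<bullet> i} \<inter> T) * P"
    if T [measurable]: "T \<in> sets borel" for T
  proof -
    define V where "V j = {a \<bullet> j..b \<bullet> j} \<inter> (if j = i then T else UNIV)" for j
    have [measurable]: "V j \<in> sets borel" for j by (simp add: V_def)
    have "emeasure lborel (cbox a b \<inter> {u. u \<bullet> i \<in> T})
        = (\<integral>\<^sup>+u. indicator (cbox a b \<inter> {u. u \<bullet> i \<in> T}) u \<partial>lborel)"
      by (rule nn_integral_indicator[symmetric]) measurable
    also have "\<dots> = (\<integral>\<^sup>+u. (\<Prod>j\<in>Basis. indicator (V j) (u \<bullet> j)) \<partial>lborel)"
    proof (intro nn_integral_cong)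
      fix u :: 'a
      have "(\<forall>j\<in>Basis. u \<bullet> j \<in> V j) \<longleftrightarrow> u \<in> cbox a b \<inter> {u. u \<bullet> i \<in> T}"
        using i by (auto simp: V_def mem_box split: if_splits)
      then show "indicator (cbox a b \<inter> {u. u \<bullet> i \<in> T}) u
          = (\<Prod>j\<in>Basis. indicator (V j) (u \<bullet> j) :: ennreal)"
        by (auto simp: indicator_def prod_zero_iff)
    qed
    also have "\<dots> = (\<Prod>j\<in>Basis. emeasure lborel (V j))"
      by (subst nn_integral_lborel_prod) auto
    also have "\<dots> = emeasure lborel (V i) * (\<Prod>j\<in>Basis - {i}. emeasure lborel (V j))"
      using i by (simp add: prod.remove)
    also have "(\<Prod>j\<in>Basis - {i}. emeasure lborel (V j)) = P"
      unfolding P_def using lt by (intro prod.cong) (auto simp: V_def less_imp_le)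
    finally show ?thesis by (simp add: V_def)
  qed
  have "emeasure ?L S = emeasure (uniform_measure lborel (cbox a b)) {u. u \<bullet> i \<in> S}"
    by (subst emeasure_distr) (auto simp: vimage_def)
  also have "\<dots> = emeasure lborel (cbox a b \<inter> {u. u \<bullet> i \<in> S}) / emeasure lborel (cbox a b)"
    by (rule emeasure_uniform_measure) measurable
  also have "emeasure lborel (cbox a b) = emeasure lborel {a \<bullet> i..b \<bullet> i} * P"
    using slab[of UNIV] by simp
  also have "emeasure lborel (cbox a b \<inter> {u. u \<bullet> i \<in> S}) / (emeasure lborel {a \<bullet> i..b \<bullet> i} * P)
      = emeasure lborel ({a \<bullet> i..b \<bullet> i} \<inter> S) / emeasure lborel {a \<bullet> i..b \<bullet> i}"
    unfolding slab[OF S] by (rule divide_mult_eq[OF P])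
  also have "\<dots> = emeasure ?R S" by simp
  finally show "emeasure ?L S = emeasure ?R S" .
qed

lemma uniform_interval_FTC:
  fixes F h :: "real \<Rightarrow> real"
  assumes ab: "a < b"
    and F: "\<And>v. (F has_real_derivative h v) (at v)"
    and h: "continuous_on UNIV h"
  shows "integrable (uniform_measure lborel {a..b}) h"
    and "(LINT v | uniform_measure lborel {a..b}. h v) = (F b - F a) / (b - a)"
proof -
  have eq: "uniform_measure lborel {a..b} = density lborel (\<lambda>v. ennreal (indicator {a..b} v / (b - a)))"
    unfolding uniform_measure_def using ab
    by (intro arg_cong[where f = "density lborel"] ext)
      (auto simp: indicator_def divide_ennreal[symmetric])
  have [measurable]: "h \<in> borel_measurable borel"
    using h by (rule borel_measurable_continuous_onI)
  have "has_bochner_integral lborel (\<lambda>v. indicator {a..b} v *\<^sub>R h v) (F b - F a)"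
    using ab F h
    by (intro has_bochner_integral_FTC_Icc)
      (auto simp: has_real_derivative_iff_has_vector_derivative[symmetric]
        intro: DERIV_subset continuous_on_subset)
  then have B: "has_bochner_integral lborel (\<lambda>v. indicator {a..b} v * h v / (b - a)) ((F b - F a) / (b - a))"
    by (auto intro: has_bochner_integral_divide_zero)
  show "integrable (uniform_measure lborel {a..b}) h"
    unfolding eq using ab B
    by (subst integrable_real_density) (auto simp: has_bochner_integral_iff)
  show "(LINT v | uniform_measure lborel {a..b}. h v) = (F b - F a) / (b - a)"
    unfolding eq using ab B
    by (subst integral_real_density) (auto simp: has_bochner_integral_iff)
qed

text \<open>Averaging over a symmetric interval keeps \<open>z\<^sup>2\<close> up to the variance \<open>\<tau>\<^sup>2 / 3\<close> of the noise, and
  multiplies an oscillation of angular frequency \<open>2 * pi\<close> by the Fourier transform of the uniform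
  density at \<open>2 * pi * \<tau>\<close>, which is \<open>s_factor \<tau>\<close>.\<close>

lemma rastrigin_coordinate_mean:
  fixes z \<tau> A :: real
  defines "h \<equiv> \<lambda>v. (z + \<tau> * v)\<^sup>2 + A * (1 - cos (2 * pi * (z + \<tau> * v)))"
  shows "integrable (uniform_measure lborel {-1..1}) h"
    and "(LINT v | uniform_measure lborel {-1..1}. h v)
      = z\<^sup>2 + \<tau>\<^sup>2 / 3 + A - A * s_factor \<tau> * cos (2 * pi * z)"
proof -
  have h: "continuous_on UNIV h" unfolding h_def by (intro continuous_intros)
  \<comment> \<open>An antiderivative of \<open>h\<close>; the general formula divides by \<open>\<tau>\<close>, whereas for \<open>\<tau> = 0\<close> the integrand
    is constant.\<close>
  define F where "F v = (if \<tau> = 0 then h 0 * v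
      else z\<^sup>2 * v + z * \<tau> * v\<^sup>2 + \<tau>\<^sup>2 * v ^ 3 / 3 + A * v - A * sin (2 * pi * (z + \<tau> * v)) / (2 * pi * \<tau>))" for v
  have F: "(F has_real_derivative h v) (at v)" for v
  proof (cases "\<tau> = 0")
    case True
    then show ?thesis unfolding F_def h_def by (auto intro!: derivative_eq_intros)
  next
    case False
    then have "F = (\<lambda>v. z\<^sup>2 * v + z * \<tau> * v\<^sup>2 + \<tau>\<^sup>2 * v ^ 3 / 3 + A * v
        - A * sin (2 * pi * (z + \<tau> * v)) / (2 * pi * \<tau>))" by (simp add: F_def fun_eq_iff)
    with False show ?thesis unfolding h_def
      by (auto intro!: derivative_eq_intros simp: field_simps power2_eq_square)
  qed
  have "(F 1 - F (-1)) / 2 = z\<^sup>2 + \<tau>\<^sup>2 / 3 + A - A * s_factor \<tau> * cos (2 * pi * z)"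
  proof (cases "\<tau> = 0")
    case True
    then show ?thesis by (simp add: F_def) (simp add: h_def s_factor_def right_diff_distrib)
  next
    case False
    have s: "sin (2 * pi * (z + \<tau>)) = sin (2 * pi * (z - \<tau>)) + 2 * (sin (2 * pi * \<tau>) * cos (2 * pi * z))"
      unfolding distrib_left right_diff_distrib sin_add sin_diff by simp
    have "(F 1 - F (-1)) / 2 = z\<^sup>2 + \<tau>\<^sup>2 / 3 + A
        - A * (sin (2 * pi * (z + \<tau>)) - sin (2 * pi * (z - \<tau>))) / (4 * pi * \<tau>)"
      using False by (simp add: F_def diff_divide_distrib add_divide_distrib right_diff_distrib)
    then show ?thesis using False unfolding s s_factor_def by simp
  qed
  with uniform_interval_FTC[of "-1" 1, OF _ F h]
  show "integrable (uniform_measure lborel {-1..1}) h"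
    and "(LINT v | uniform_measure lborel {-1..1}. h v)
      = z\<^sup>2 + \<tau>\<^sup>2 / 3 + A - A * s_factor \<tau> * cos (2 * pi * z)" by auto
qed

lemma power2_norm_vec: "(norm v)\<^sup>2 = (\<Sum>i\<in>UNIV. (v $ i)\<^sup>2)" for v :: "real ^ 'n"
  by (simp add: norm_vec_def L2_set_def sum_nonneg)

text \<open>Smoothing preserves the separable form, and the amplitude \<open>A\<close> of the cosines becomes
  \<open>A * s_factor \<tau>\<close>. The differentiability claims and the case of \<open>\<tau>\<close> a multiple of \<open>1/2\<close> are
  read off from this formula.\<close>

lemma smoothing_rastrigin:
  fixes xs x :: "real ^ 'n"
  shows "smoothing \<tau> (rastrigin A xs) x
    = (\<Sum>i\<in>UNIV. (x $ i - xs $ i)\<^sup>2 + \<tau>\<^sup>2 / 3 + A - A * s_factor \<tau> * cos (2 * pi * (x $ i - xs $ i)))"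
proof -
  define M :: "(real ^ 'n) measure" where "M = uniform_measure lborel (cbox (\<chi> i. - 1) (\<chi> i. 1))"
  define h where "h i v = (x $ i - xs $ i + \<tau> * v)\<^sup>2
      + A * (1 - cos (2 * pi * (x $ i - xs $ i + \<tau> * v)))" for i v
  have marginal: "distr M borel (\<lambda>u. u $ i) = uniform_measure lborel {-1..1}" for i
  proof -
    have "(\<chi> i. - 1) \<bullet> j < (\<chi> i. 1) \<bullet> j" if "j \<in> Basis" for j :: "real ^ 'n"
      using that by (auto simp: Basis_vec_def inner_axis)
    from distr_uniform_cbox_component[OF this, of "axis i 1"] show ?thesis
      by (simp add: M_def cart_eq_inner_axis[symmetric] axis_in_Basis_iff)
  qed
  have [measurable]: "(\<lambda>u. u $ i) \<in> borel_measurable M" for i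
    by (simp add: M_def)
  have [measurable]: "h i \<in> borel_measurable borel" for i
    unfolding h_def by measurable
  have int: "integrable M (\<lambda>u. h i (u $ i))"
    and mean: "(LINT u | M. h i (u $ i)) = (x $ i - xs $ i)\<^sup>2 + \<tau>\<^sup>2 / 3 + A
      - A * s_factor \<tau> * cos (2 * pi * (x $ i - xs $ i))" for i
    using rastrigin_coordinate_mean[of "x $ i - xs $ i" \<tau> A]
      integrable_distr_eq[of "\<lambda>u. u $ i" M borel "h i"] integral_distr[of "\<lambda>u. u $ i" M borel "h i"]
    by (simp_all add: marginal h_def[abs_def])
  have "rastrigin A xs (x + \<tau> *\<^sub>R u) = (\<Sum>i\<in>UNIV. h i (u $ i))" for u
    unfolding rastrigin_def power2_norm_vec sum_distrib_left sum.distrib[symmetric] h_def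
    by (intro sum.cong) (simp_all add: algebra_simps)
  then show ?thesis
    unfolding smoothing_def M_def[symmetric] by (simp add: int mean)
qed
lemma has_derivative_smoothing_rastrigin:
  fixes xs x :: "real ^ 'n"
  shows "(smoothing \<tau> (rastrigin A xs) has_derivative
    (\<lambda>h. \<Sum>i\<in>UNIV. (2 * (x $ i - xs $ i) + c_coeff A \<tau> * sin (2 * pi * (x $ i - xs $ i))) * h $ i)) (at x)"
  unfolding smoothing_rastrigin[abs_def]
  by (auto intro!: derivative_eq_intros bounded_linear_imp_has_derivative bounded_linear_vec_nth sum.cong
      simp: c_coeff_def fun_eq_iff algebra_simps)

lemma has_real_derivative_smoothing_rastrigin_axis:
  fixes xs x :: "real ^ 'n"
  shows "((\<lambda>t. smoothing \<tau> (rastrigin A xs) (x + t *\<^sub>R axis i 1)) has_real_derivative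
    2 * (x $ i - xs $ i) + c_coeff A \<tau> * sin (2 * pi * (x $ i - xs $ i))) (at 0)"
proof -
  let ?g = "\<lambda>i. 2 * (x $ i - xs $ i) + c_coeff A \<tau> * sin (2 * pi * (x $ i - xs $ i))"
  have "((\<lambda>t. x + t *\<^sub>R axis i 1) has_derivative (\<lambda>t. t *\<^sub>R axis i 1)) (at 0)"
    by (auto intro!: derivative_eq_intros)
  moreover have "(smoothing \<tau> (rastrigin A xs) has_derivative (\<lambda>h. \<Sum>j\<in>UNIV. ?g j * h $ j))
      (at (x + 0 *\<^sub>R axis i 1))"
    using has_derivative_smoothing_rastrigin by simp
  ultimately have "((\<lambda>t. smoothing \<tau> (rastrigin A xs) (x + t *\<^sub>R axis i 1)) has_derivative
      (\<lambda>t. \<Sum>j\<in>UNIV. ?g j * (t *\<^sub>R axis i 1 :: real ^ 'n) $ j)) (at 0)"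
    by (rule has_derivative_compose)
  moreover have "(\<Sum>j\<in>UNIV. ?g j * (t *\<^sub>R axis i 1 :: real ^ 'n) $ j) = ?g i * t" for t
    by (simp add: axis_def if_distrib cong: if_cong)
  ultimately show ?thesis by (simp add: has_field_derivative_def)
qed

lemma partial_differentiable_smoothing_rastrigin:
  "partial_differentiable i (smoothing \<tau> (rastrigin A xs)) x"
  unfolding partial_differentiable_def field_differentiable_def
  using has_real_derivative_smoothing_rastrigin_axis by blast

lemma partial_deriv_smoothing_rastrigin:
  "partial_deriv i (smoothing \<tau> (rastrigin A xs)) x
    = 2 * (x $ i - xs $ i) + c_coeff A \<tau> * sin (2 * pi * (x $ i - xs $ i))"
  unfolding partial_deriv_def by (rule DERIV_imp_deriv has_real_derivative_smoothing_rastrigin_axis)+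

section \<open>The upper threshold\<close>

text \<open>Sine is convex on this half period. The tangent inequality is used at the exact critical angle,
  where it shows that the minimum of \<open>ratio\<close> is attained, and at a rational shift of \<open>3 / 2 * pi\<close>,
  where it gives a numerical lower bound.\<close>

lemma sin_above_tangent:
  assumes "\<theta> \<in> {pi..2 * pi}" "\<theta>\<^sub>0 \<in> {pi<..<2 * pi}"
  shows "sin \<theta> \<ge> sin \<theta>\<^sub>0 + cos \<theta>\<^sub>0 * (\<theta> - \<theta>\<^sub>0)"
proof -
  have "convex_on {pi..2 * pi} sin"
  proof (rule f''_ge0_imp_convex)
    show "- sin x \<ge> 0" if "x \<in> {pi..2 * pi}" for x :: real
      using that sin_le_zero[of x] by (cases "x = 2 * pi") auto
  qed (auto intro!: derivative_eq_intros)
  moreover have "(sin has_real_derivative cos \<theta>\<^sub>0) (at \<theta>\<^sub>0 within {pi..2 * pi})"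
    by (auto intro!: derivative_eq_intros)
  ultimately have "sin \<theta> - sin \<theta>\<^sub>0 \<ge> cos \<theta>\<^sub>0 * (\<theta> - \<theta>\<^sub>0)"
    using assms by (intro convex_on_imp_above_tangent[where A = "{pi..2 * pi}"]) auto
  then show ?thesis by simp
qed

lemma ratio_le_iff:
  assumes "t \<in> {1/2<..<1}"
  shows "c \<le> ratio t \<longleftrightarrow> c * - sin (2 * pi * t) \<le> 2 * t"
    and "c < ratio t \<longleftrightarrow> 0 < 2 * t + c * sin (2 * pi * t)"
proof -
  have "sin (2 * pi * t) < 0" using assms by (intro sin_lt_zero) auto
  then show "c \<le> ratio t \<longleftrightarrow> c * - sin (2 * pi * t) \<le> 2 * t"
    and "c < ratio t \<longleftrightarrow> 0 < 2 * t + c * sin (2 * pi * t)"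
    by (auto simp: ratio_def field_simps)
qed

text \<open>The minimiser is \<open>t = \<theta> / (2 * pi)\<close> with \<open>tan \<theta> = \<theta>\<close>. At such an angle the tangent to the sine
  curve passes through the origin, so by convexity the curve lies above the line through the origin
  of slope \<open>cos \<theta> = sin \<theta> / \<theta>\<close>; this bounds \<open>- sin\<close> by a multiple of the angle, with equality at
  \<open>\<theta>\<close>.\<close>

lemma ratio_attains_min:
  obtains t where "t \<in> {1/2<..<1}" "\<And>t'. t' \<in> {1/2<..<1} \<Longrightarrow> ratio t \<le> ratio t'"
proof -
  have "\<exists>\<theta>\<ge>pi. \<theta> \<le> 3 / 2 * pi \<and> \<theta> * cos \<theta> - sin \<theta> = 0"
  proof (rule IVT')
    have "cos (3 / 2 * pi) = 0" "sin (3 / 2 * pi) = - 1"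
      using cos_3over2_pi sin_3over2_pi by (simp_all add: mult.commute)
    then show "0 \<le> 3 / 2 * pi * cos (3 / 2 * pi) - sin (3 / 2 * pi)" by simp
  qed (auto intro!: continuous_intros)
  then obtain \<theta> where \<theta>: "pi \<le> \<theta>" "\<theta> \<le> 3 / 2 * pi" and crit: "sin \<theta> = \<theta> * cos \<theta>" by auto
  have "\<theta> \<noteq> pi" using crit by auto
  with \<theta> have \<theta>': "\<theta> \<in> {pi<..<2 * pi}" by auto
  define t where "t = \<theta> / (2 * pi)"
  have t: "t \<in> {1/2<..<1}" "2 * pi * t = \<theta>" using \<theta>' by (auto simp: t_def field_simps)
  have "ratio t \<le> ratio t'" if t': "t' \<in> {1/2<..<1}" for t'
  proof -
    have "2 * pi * t' \<in> {pi..2 * pi}" using t' by auto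
    from sin_above_tangent[OF this \<theta>'] have "\<theta> * cos \<theta> + cos \<theta> * (2 * pi * t' - \<theta>) \<le> sin (2 * pi * t')"
      by (simp add: crit)
    then have le: "- sin (2 * pi * t') \<le> - cos \<theta> * (2 * pi * t')" by (simp add: algebra_simps)
    have neg: "sin \<theta> < 0" using \<theta>' by (intro sin_lt_zero) auto
    then have c: "cos \<theta> < 0" using crit \<theta>' pi_gt_zero by (simp add: mult_less_0_iff)
    have r: "ratio t = 1 / (pi * - cos \<theta>)"
      unfolding ratio_def t(2) crit using c \<theta>' by (simp add: t_def field_simps)
    have "ratio t * - sin (2 * pi * t') \<le> ratio t * (- cos \<theta> * (2 * pi * t'))"
      using c by (intro mult_left_mono[OF le]) (simp add: r mult_nonneg_nonpos)
    also have "\<dots> = 2 * t'" unfolding r using c by simp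
    finally show ?thesis using ratio_le_iff(1)[OF t'] by blast
  qed
  with t(1) show ?thesis using that by blast
qed

lemma c_plus_is_min:
  shows "\<exists>t\<in>{1/2<..<1}. ratio t = c_plus \<and> (\<forall>t'\<in>{1/2<..<1}. ratio t \<le> ratio t')"
proof -
  obtain t where t: "t \<in> {1/2<..<1}" "\<And>t'. t' \<in> {1/2<..<1} \<Longrightarrow> ratio t \<le> ratio t'"
    using ratio_attains_min by blast
  then have "c_plus = ratio t" unfolding c_plus_def by (intro Least_equality) auto
  with t show ?thesis by (intro bexI[of _ t]) auto
qed

lemma cos_Taylor6:
  fixes x :: real
  defines "T \<equiv> 1 - x^2 / 2 + x^4 / 24 - x^6 / 720"
  shows "cos x \<le> T + x^8 / 40320" and "T - x^8 / 40320 \<le> cos x"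
proof -
  obtain t where cos: "cos x = (\<Sum>m<8. cos_coeff m * x ^ m) + (cos (t + 1/2 * real 8 * pi) / fact 8) * x ^ 8"
    using Maclaurin_cos_expansion[of x 8] by auto
  define R where "R = (cos (t + 1/2 * real 8 * pi) / fact 8) * x ^ 8"
  have "(\<Sum>m<8. cos_coeff m * x ^ m) = T"
    by (simp add: T_def lessThan_nat_numeral cos_coeff_def fact_numeral)
  then have "cos x = T + R" using cos by (simp add: R_def)
  moreover have "\<bar>R\<bar> \<le> x ^ 8 / 40320"
    using mult_right_mono[OF abs_cos_le_one[of "t + 1/2 * real 8 * pi"], of "x ^ 8 / 40320"]
    by (simp add: R_def abs_mult fact_numeral)
  ultimately show "cos x \<le> T + x^8 / 40320" and "T - x^8 / 40320 \<le> cos x"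
    by (simp_all add: abs_le_iff)
qed

text \<open>Both bounds have a margin of a few parts in a million, which forces the choice of points close to
  the critical angle \<open>4.493409\<dots>\<close>. For the lower bound the tangent is taken at \<open>3 / 2 * pi - w\<close>
  with \<open>w\<close> close to the solution of \<open>sin w = 1 / (1.46528 * pi)\<close>: multiplied by \<open>1.46528\<close>, the
  tangent is then almost parallel to the line \<open>\<theta> / pi\<close>, and the comparison loses little over the
  whole interval. For the upper bound it is enough to evaluate \<open>ratio\<close> at a single point.\<close>

lemma c_plus_bounds: "1.46528 \<le> c_plus" "c_plus < 1.46529"
proof -
  note pi = pi_approx
  define w :: real where "w = 0.218981"
  have cw: "cos w \<le> 0.9761194"
    using cos_Taylor6(1)[of w] by (simp add: w_def power_numeral_reduce)
  have sw: "\<bar>sin w - 0.217235\<bar> \<le> 0.0000001"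
    using Maclaurin_sin_bound[of w 7] unfolding abs_le_iff
    by (simp add: w_def lessThan_nat_numeral sin_coeff_def fact_numeral power_numeral_reduce)
  have lower: "1.46528 \<le> ratio t" if t: "t \<in> {1/2<..<1}" for t
  proof -
    define \<theta> where "\<theta> = 2 * pi * t"
    have \<theta>: "pi \<le> \<theta>" "\<theta> \<le> 2 * pi" using t by (auto simp: \<theta>_def)
    have shift: "sin (3 / 2 * pi - w) = - cos w" "cos (3 / 2 * pi - w) = - sin w"
      using cos_3over2_pi sin_3over2_pi by (simp_all add: sin_diff cos_diff mult.commute)
    have "sin (3 / 2 * pi - w) + cos (3 / 2 * pi - w) * (\<theta> - (3 / 2 * pi - w)) \<le> sin \<theta>"
      using \<theta> pi by (intro sin_above_tangent) (auto simp: w_def)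
    then have "- sin \<theta> \<le> cos w + sin w * (\<theta> - (3 / 2 * pi - w))"
      unfolding shift by (simp add: algebra_simps)
    moreover have "sin w * (\<theta> - (3 / 2 * pi - w)) \<le> 0.217235 * (\<theta> - (3 / 2 * pi - w)) + 0.0000001 * 2"
    proof -
      have "\<bar>\<theta> - (3 / 2 * pi - w)\<bar> \<le> 2" using \<theta> pi by (simp add: w_def abs_le_iff)
      then have "\<bar>(sin w - 0.217235) * (\<theta> - (3 / 2 * pi - w))\<bar> \<le> 0.0000001 * 2"
        unfolding abs_mult using sw by (intro mult_mono) auto
      from abs_le_D1[OF this] show ?thesis unfolding left_diff_distrib by linarith
    qed
    ultimately have "- sin \<theta> \<le> 0.9761194 + (0.217235 * (\<theta> - (3 / 2 * pi - w)) + 0.0000001 * 2)"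
      using cw by linarith
    then have "1.46528 * - sin \<theta> \<le> \<theta> * (1 / 3.1415926535899)"
      using \<theta> pi by (simp add: w_def field_simps)
    also have "\<dots> \<le> \<theta> * (1 / pi)" using \<theta> pi by (intro mult_left_mono divide_left_mono) auto
    also have "\<dots> = 2 * t" by (simp add: \<theta>_def)
    finally show ?thesis using ratio_le_iff(1)[OF t] by (simp add: \<theta>_def)
  qed
  with c_plus_is_min show "1.46528 \<le> c_plus" by metis
  \<comment> \<open>The point \<open>0.71515\<close> approximates the critical angle divided by \<open>2 * pi\<close>; its distance to \<open>3/4\<close>
    is half of \<open>0.0697\<close>, and \<open>0.218969008\<close> bounds \<open>0.0697 * pi\<close> from above.\<close>
  have "2 * 0.71515 / 1.46529 < cos (0.218969008 :: real)"
    using cos_Taylor6(2)[of "0.218969008"] by (simp add: power_numeral_reduce)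
  also have "\<dots> \<le> cos (0.0697 * pi)"
    using pi by (intro cos_monotone_0_pi_le) auto
  also have "cos (0.0697 * pi) = - sin (3 / 2 * pi - 0.0697 * pi)"
    unfolding sin_diff using cos_3over2_pi sin_3over2_pi by (simp add: mult.commute)
  also have "3 / 2 * pi - 0.0697 * pi = 2 * pi * 0.71515" by simp
  finally have "ratio 0.71515 < 1.46529" by (simp add: ratio_def field_simps)
  moreover have "c_plus \<le> ratio 0.71515" using c_plus_is_min by auto
  ultimately show "c_plus < 1.46529" by simp
qed

section \<open>Sign of the partial derivatives\<close>

lemma abs_sin_less_self:
  assumes "0 < (x :: real)"
  shows "\<bar>sin x\<bar> < x"
proof (cases "x < pi")
  case True
  obtain z where z: "0 < z" "z < x" and "sin x - sin 0 = (x - 0) * cos z"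
    using MVT2[OF assms, of sin cos] by (auto intro: derivative_eq_intros)
  moreover have "cos z < 1" using cos_monotone_0_pi[of 0 z] z True by simp
  ultimately have "sin x < x" using assms by simp
  then show ?thesis using sin_gt_zero[OF assms True] by simp
next
  case False
  then show ?thesis using pi_ge_two abs_sin_le_one[of x] by linarith
qed

text \<open>The lower threshold comes from \<open>y\<close> near zero: the slope at zero is \<open>2 + 2 * pi * c\<close>, and conversely
  \<open>\<bar>sin z\<bar> < z\<close> covers all \<open>y\<close> at once when \<open>- 1 / pi \<le> c < 0\<close>. The upper threshold comes from
  the first interval on which the sine is negative: there positivity is the inequality
  \<open>c < ratio y\<close>. Beyond \<open>y = 1\<close> the linear term is at least \<open>2\<close>, which exceeds \<open>c_plus\<close>.\<close>

lemma derivative_sign_iff: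
  "(\<forall>y>0. 0 < 2 * y + c * sin (2 * pi * y)) \<longleftrightarrow> - (1 / pi) \<le> c \<and> c < c_plus"
proof (intro iffI conjI)
  assume pos: "\<forall>y>0. 0 < 2 * y + c * sin (2 * pi * y)"
  obtain t where t: "t \<in> {1/2<..<1}" "ratio t = c_plus" using c_plus_is_min by blast
  then show "c < c_plus" using pos ratio_le_iff(2)[of t c] by auto
  show "- (1 / pi) \<le> c"
  proof (rule ccontr)
    assume "\<not> ?thesis"
    then have "2 + 2 * pi * c < 0" by (simp add: field_simps)
    moreover have "((\<lambda>y. 2 * y + c * sin (2 * pi * y)) has_real_derivative 2 + 2 * pi * c) (at 0)"
      by (auto intro!: derivative_eq_intros)
    ultimately obtain d where d: "d > 0" "\<forall>h>0. h < d \<longrightarrow> 2 * 0 + c * sin (2 * pi * 0) > 2 * (0 + h) + c * sin (2 * pi * (0 + h))"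
      using DERIV_neg_dec_right by blast
    from d(1) d(2)[rule_format, of "d / 2"] have "2 * (d / 2) + c * sin (2 * pi * (d / 2)) < 0" by simp
    with pos[rule_format, of "d / 2"] d(1) show False by linarith
  qed
next
  assume c: "- (1 / pi) \<le> c \<and> c < c_plus"
  show "\<forall>y>0. 0 < 2 * y + c * sin (2 * pi * y)"
  proof (intro allI impI)
    fix y :: real assume y: "y > 0"
    show "0 < 2 * y + c * sin (2 * pi * y)"
    proof (cases "c < 0")
      case True
      have "\<bar>sin (2 * pi * y)\<bar> < 2 * pi * y" using y by (intro abs_sin_less_self) auto
      moreover have "\<bar>c\<bar> \<le> 1 / pi" using c True by auto
      ultimately have "\<bar>c * sin (2 * pi * y)\<bar> < 1 / pi * (2 * pi * y)"
        unfolding abs_mult using True by (intro mult_le_less_imp_less) auto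
      then show ?thesis by simp
    next
      case False
      consider "y \<le> 1/2" | "y \<in> {1/2<..<1}" | "y \<ge> 1" by fastforce
      then show ?thesis
      proof cases
        case 1
        then have "0 \<le> sin (2 * pi * y)" using y by (intro sin_ge_zero) auto
        then show ?thesis using y False by (simp add: add_pos_nonneg)
      next
        case 2
        then show ?thesis using c c_plus_is_min ratio_le_iff(2)[OF 2, of c] by fastforce
      next
        case 3
        have "c * - sin (2 * pi * y) \<le> c * 1" using False by (intro mult_left_mono) auto
        then show ?thesis using 3 c c_plus_bounds by simp
      qed
    qed
  qed
qed

theorem propositionE6:
  fixes xs :: "real ^ 'n" and A :: real
  assumes "A > 0"
  shows "(\<exists>t\<in>{1/2<..<1}. ratio t = c_plus \<and> (\<forall>t'\<in>{1/2<..<1}. ratio t \<le> ratio t'))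
    \<and> 1.46528 \<le> c_plus \<and> c_plus < 1.46529
    \<and> (\<forall>\<tau>\<ge>0.
        (\<forall>x i. partial_differentiable i (smoothing \<tau> (rastrigin A xs)) x \<and>
           partial_deriv i (smoothing \<tau> (rastrigin A xs)) x
             = 2 * (x $ i - xs $ i) + c_coeff A \<tau> * sin (2 * pi * (x $ i - xs $ i))) \<and>
        (smoothing \<tau> (rastrigin A xs) \<in> class_U xs \<longleftrightarrow>
           - (1 / pi) \<le> c_coeff A \<tau> \<and> c_coeff A \<tau> < c_plus))
    \<and> (\<forall>\<tau>\<ge>pi * A. \<bar>c_coeff A \<tau>\<bar> \<le> A / \<tau> \<and> A / \<tau> \<le> 1 / pi \<and>
         - (1 / pi) \<le> c_coeff A \<tau> \<and> c_coeff A \<tau> < c_plus)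
    \<and> (\<forall>(k::nat)\<ge>1. s_factor (real k / 2) = 0 \<and>
         (\<exists>C. \<forall>x. smoothing (real k / 2) (rastrigin A xs) x = (norm (x - xs))\<^sup>2 + C))"
proof -
  have class_U_iff: "smoothing \<tau> (rastrigin A xs) \<in> class_U xs \<longleftrightarrow>
      - (1 / pi) \<le> c_coeff A \<tau> \<and> c_coeff A \<tau> < c_plus" for \<tau>
  proof -
    define D where "D y = 2 * y + c_coeff A \<tau> * sin (2 * pi * y)" for y
    have odd: "D (- y) = - D y" for y by (simp add: D_def)
    have "smoothing \<tau> (rastrigin A xs) differentiable (at x)" for x
      using has_derivative_smoothing_rastrigin by (rule differentiableI)
    then have "smoothing \<tau> (rastrigin A xs) \<in> class_U xs \<longleftrightarrow>
        (\<forall>x i. x $ i \<noteq> xs $ i \<longrightarrow> D (x $ i - xs $ i) * (x $ i - xs $ i) > 0)"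
      by (simp add: class_U_def partial_deriv_smoothing_rastrigin D_def)
    also have "\<dots> \<longleftrightarrow> (\<forall>y>0. 0 < D y)"
    proof (intro iffI allI impI)
      fix y :: real
      assume U: "\<forall>x i. x $ i \<noteq> xs $ i \<longrightarrow> D (x $ i - xs $ i) * (x $ i - xs $ i) > 0" and "y > 0"
      then show "0 < D y"
        using U[rule_format, of "xs + y *\<^sub>R axis i 1" i for i] by (simp add: zero_less_mult_iff)
    next
      fix x :: "real ^ 'n" and i
      assume pos: "\<forall>y>0. 0 < D y" and "x $ i \<noteq> xs $ i"
      then consider "x $ i - xs $ i > 0" | "- (x $ i - xs $ i) > 0" by linarith
      then show "D (x $ i - xs $ i) * (x $ i - xs $ i) > 0"
      proof cases
        case 1
        then show ?thesis using pos by simp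
      next
        case 2
        then have "D (x $ i - xs $ i) < 0" using pos odd by (metis neg_0_less_iff_less)
        then show ?thesis using 2 by (simp add: mult_neg_neg)
      qed
    qed
    also have "\<dots> \<longleftrightarrow> - (1 / pi) \<le> c_coeff A \<tau> \<and> c_coeff A \<tau> < c_plus"
      unfolding D_def by (rule derivative_sign_iff)
    finally show ?thesis .
  qed
  have large: "\<bar>c_coeff A \<tau>\<bar> \<le> A / \<tau> \<and> A / \<tau> \<le> 1 / pi \<and>
      - (1 / pi) \<le> c_coeff A \<tau> \<and> c_coeff A \<tau> < c_plus" if \<tau>: "\<tau> \<ge> pi * A" for \<tau>
  proof -
    have pos: "\<tau> > 0" using \<tau> assms by (meson less_le_trans mult_pos_pos pi_gt_zero)
    then have "c_coeff A \<tau> = A / \<tau> * sin (2 * pi * \<tau>)"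
      by (simp add: c_coeff_def s_factor_def)
    then have le: "\<bar>c_coeff A \<tau>\<bar> \<le> A / \<tau>"
      using mult_left_mono[OF abs_sin_le_one[of "2 * pi * \<tau>"], of "A / \<tau>"] assms pos
      by (simp add: abs_mult)
    moreover have "A / \<tau> \<le> 1 / pi" using \<tau> pos by (simp add: field_simps)
    moreover have "1 / 2 < c_plus" using c_plus_bounds(1) by simp
    moreover have "1 / pi \<le> 1 / 2" using pi_ge_two by (intro divide_left_mono) auto
    ultimately show ?thesis by (intro conjI) linarith+
  qed
  have half: "s_factor (real k / 2) = 0 \<and>
      (\<exists>C. \<forall>x. smoothing (real k / 2) (rastrigin A xs) x = (norm (x - xs))\<^sup>2 + C)" if "k \<ge> 1" for k
  proof -
    have s: "s_factor (real k / 2) = 0" using that by (simp add: s_factor_def)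
    then have "smoothing (real k / 2) (rastrigin A xs) x
        = (norm (x - xs))\<^sup>2 + (\<Sum>i\<in>(UNIV :: 'n set). (real k / 2)\<^sup>2 / 3 + A)" for x
      unfolding smoothing_rastrigin power2_norm_vec sum.distrib[symmetric] by (simp add: add.assoc)
    with s show ?thesis by blast
  qed
  show ?thesis
    using c_plus_is_min c_plus_bounds class_U_iff large half
    by (simp add: partial_differentiable_smoothing_rastrigin partial_deriv_smoothing_rastrigin)
qed

end
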